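(* Let $\beta,\beta'\in\mathbb{C}\setminus\{0\}$ and $\rho,\rho'\in\mathcal{P}$. Then the lattices $\Lambda\langle\beta,\rho\rangle$ and $\Lambda\langle\beta',\rho'\rangle$ are equivalent (that is, equal as subsets of $\mathbb{C}$) if and only if there exist $k_1,k_2,k_3,k_4\in\mathbb{Z}$ with $k_1k_4-k_2k_3=1$ such that $$\beta'=e^{i\,\mathrm{Arg}(k_1+k_2\rho)}\,\beta\qquad\text{and}\qquad \rho'=\frac{k_3+k_4\rho}{k_1+k_2\rho}.$$
   Context: For $(b_1,b_2)\in\mathbb{C}^2$ with $b_1\neq 0$ and $\mathrm{Im}(b_2/b_1)\neq 0$, the 2D lattice with basis $(b_1,b_2)$ is $\Lambda(b_1,b_2)=\{k_1b_1+k_2b_2 : k_1,k_2\in\mathbb{Z}\}$. Bases are assumed ordered and positive: $|b_1|\le|b_2|$ and $\mathrm{Im}(b_2/b_1)>0$. A basis is minimal if $\max(|b_1|,|b_2|)\le|b_1\pm b_2|$ (for both signs). Given a lattice with such a minimal basis $(b_1,b_2)$, its scale descriptor is $\beta=b_1$ and its shape descriptor is $\rho=b_2/b_1$; one writes $\Lambda\langle\beta,\rho\rangle=\Lambda(\beta,\beta\rho)$. Under these conventions, minimality of $(\beta,\beta\rho)$ means exactly that $\beta\in\mathbb{C}\setminus\{0\}$ and $\rho\in\mathcal{P}$, where $$\mathcal{P}=\{z\in\mathbb{C} : |z|\ge 1,\ |\mathrm{Re}(z)|\le \tfrac12,\ \mathrm{Im}(z)>0\}.$$ $\mathrm{Arg}(z)$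 denotes the argument of a nonzero complex number $z$, so $e^{i\,\mathrm{Arg}(z)}=z/|z|$. *)

theory Defs
  imports "HOL-Analysis.Analysis"
begin

definition lattice_of_basis :: "complex \<Rightarrow> complex \<Rightarrow> complex set" where
  "lattice_of_basis b1 b2 = {of_int k1 * b1 + of_int k2 * b2 | k1 k2 :: int. True}"

definition lattice_of_descriptors :: "complex \<Rightarrow> complex \<Rightarrow> complex set" where
  "lattice_of_descriptors \<beta> \<rho> = lattice_of_basis \<beta> (\<beta> * \<rho>)"

text \<open>
  The admissible shape descriptors. For \<open>\<beta> \<noteq> 0\<close>, membership of \<open>\<rho>\<close> says exactly that
  \<open>(\<beta>, \<beta> * \<rho>)\<close> is an ordered, positive and minimal basis. Both vertical sides and the
  whole bounding arc belong to the region, so a lattice may have several shape descriptors.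
\<close>

definition shape_descriptors :: "complex set" where
  "shape_descriptors = {z. norm z \<ge> 1 \<and> \<bar>Re z\<bar> \<le> 1 / 2 \<and> Im z > 0}"

end

theory Submission
  imports Defs
begin

text \<open>
  A nonzero vector \<open>k1 + k2 * \<rho>\<close> of the lattice spanned by \<open>1\<close> and a shape descriptor \<open>\<rho>\<close> has
  norm at least \<open>1\<close>. Applied to a change of basis and to its inverse, this forces
  \<open>norm (k1 + k2 * \<rho>) = 1\<close>, so that \<open>k1 + k2 * \<rho>\<close> is the exponential of its argument. The
  determinant is read off from the imaginary parts, since
  \<open>Im \<rho>' = (k1 * k4 - k2 * k3) * Im \<rho> / (norm (k1 + k2 * \<rho>))\<^sup>2\<close>.
\<close>

lemma exp_i_Arg: "norm z = 1 \<Longrightarrow> exp (\<i> * of_real (Arg z)) = z"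
  using Arg_eq[of z] by fastforce

text \<open>Expanding the squared norm gives \<open>k\<^sup>2 + 2 * k * l * Re \<rho> + l\<^sup>2 *
  (norm \<rho>)\<^sup>2\<close>. The bounds on \<open>Re \<rho>\<close> and
  \<open>norm \<rho>\<close> make this at least
  \<open>k\<^sup>2 - \<bar>k * l\<bar> + l\<^sup>2\<close>, a positive integer.\<close>

lemma norm_lattice_vector_ge_1:
  fixes k l :: int
  assumes "\<rho> \<in> shape_descriptors" and "of_int k + of_int l * \<rho> \<noteq> 0"
  shows "1 \<le> norm (of_int k + of_int l * \<rho>)"
proof -
  have "k \<noteq> 0 \<or> l \<noteq> 0"
    using assms(2) by auto
  have "1 \<le> k\<^sup>2 - \<bar>k * l\<bar> + l\<^sup>2"
  proof -
    have "\<bar>k * l\<bar> = \<bar>k\<bar> * \<bar>l\<bar>" "k\<^sup>2 = \<bar>k\<bar>\<^sup>2" "l\<^sup>2 = \<bar>l\<bar>\<^sup>2"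
      by (simp_all add: abs_mult)
    \<comment> \<open>Completing the square: the right-hand side is four times the form, so the form
      is a positive integer.\<close>
    moreover have "0 < (2 * \<bar>k\<bar> - \<bar>l\<bar>)\<^sup>2 + 3 * \<bar>l\<bar>\<^sup>2"
      using \<open>k \<noteq> 0 \<or> l \<noteq> 0\<close> by (cases "l = 0") (auto intro!: add_nonneg_pos)
    ultimately show ?thesis
      by (simp add: power2_eq_square algebra_simps)
  qed
  then have "real_of_int 1 \<le> of_int (k\<^sup>2 - \<bar>k * l\<bar> + l\<^sup>2)"
    by (simp only: of_int_le_iff)
  moreover have "- \<bar>real_of_int (k * l)\<bar> \<le> 2 * of_int (k * l) * Re \<rho>"
  proof -
    have "\<bar>2 * of_int (k * l) * Re \<rho>\<bar> = \<bar>real_of_int (k * l)\<bar> * (2 * \<bar>Re \<rho>\<bar>)"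
      by (simp add: abs_mult)
    also have "\<dots> \<le> \<bar>real_of_int (k * l)\<bar> * 1"
      using assms(1) by (intro mult_left_mono) (auto simp: shape_descriptors_def)
    finally show ?thesis by linarith
  qed
  moreover have "(real_of_int l)\<^sup>2 \<le> (of_int l)\<^sup>2 * (norm \<rho>)\<^sup>2"
    using assms(1) mult_left_mono[of 1 "(norm \<rho>)\<^sup>2" "(real_of_int l)\<^sup>2"]
    by (simp add: shape_descriptors_def)
  moreover have "(norm (of_int k + of_int l * \<rho>))\<^sup>2 =
      (of_int k)\<^sup>2 + 2 * of_int (k * l) * Re \<rho> + (of_int l)\<^sup>2 * (norm \<rho>)\<^sup>2"
    unfolding cmod_power2 by (simp add: power2_eq_square algebra_simps)
  ultimately have "1\<^sup>2 \<le> (norm (of_int k + of_int l * \<rho>))\<^sup>2"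
    by simp
  then show ?thesis
    by (rule power2_le_imp_le) simp
qed

lemma Im_moebius:
  fixes a b c d :: int
  shows "Im ((of_int c + of_int d * z) / (of_int a + of_int b * z)) =
    of_int (a * d - b * c) * Im z / (norm (of_int a + of_int b * z))\<^sup>2"
  unfolding cmod_power2 by (simp add: Im_divide algebra_simps power2_eq_square)

text \<open>Used with \<open>a\<close> and \<open>b\<close> as the new and old scales: dividing the
  expansions of the two new basis vectors cancels the scale and leaves the fractional linear formula
  for the new shape.\<close>

lemma quotient_eqI:
  fixes a b r u w :: "'a :: field"
  assumes "a \<noteq> 0" and "a = u * b" and "a * r = w * b"
  shows "r = w / u"
proof -
  have "b \<noteq> 0" "u \<noteq> 0"
    using assms(1,2) by auto
  moreover have "(r * u) * b = w * b"
    using assms(2,3) by (simp add: mult_ac)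
  ultimately show ?thesis
    by (simp add: eq_divide_eq)
qed

lemma lattice_of_basis_subset:
  assumes "b1 \<in> lattice_of_basis c1 c2" and "b2 \<in> lattice_of_basis c1 c2"
  shows "lattice_of_basis b1 b2 \<subseteq> lattice_of_basis c1 c2"
proof
  fix x assume "x \<in> lattice_of_basis b1 b2"
  then obtain m n :: int where x: "x = of_int m * b1 + of_int n * b2"
    by (auto simp: lattice_of_basis_def)
  obtain p q r s :: int
    where b: "b1 = of_int p * c1 + of_int q * c2" "b2 = of_int r * c1 + of_int s * c2"
    using assms by (auto simp: lattice_of_basis_def)
  have "x = of_int (m * p + n * r) * c1 + of_int (m * q + n * s) * c2"
    by (simp add: x b algebra_simps)
  then show "x \<in> lattice_of_basis c1 c2"
    unfolding lattice_of_basis_def by blast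
qed

text \<open>Inclusion need only be tested on the two basis vectors. An equality of lattices thus
  becomes a pair of integer coefficient matrices, one for each inclusion.\<close>

lemma lattice_of_descriptors_subset_iff:
  "lattice_of_descriptors \<beta>' \<rho>' \<subseteq> lattice_of_descriptors \<beta> \<rho> \<longleftrightarrow>
    (\<exists>k1 k2 k3 k4 :: int. \<beta>' = (of_int k1 + of_int k2 * \<rho>) * \<beta> \<and>
      \<beta>' * \<rho>' = (of_int k3 + of_int k4 * \<rho>) * \<beta>)" (is "?L \<longleftrightarrow> ?R")
proof -
  have mem: "x \<in> lattice_of_descriptors \<beta> \<rho> \<longleftrightarrow>
      (\<exists>k l :: int. x = (of_int k + of_int l * \<rho>) * \<beta>)" for x
    by (simp add: lattice_of_descriptors_def lattice_of_basis_def algebra_simps)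
  have "\<beta>' = of_int 1 * \<beta>' + of_int 0 * (\<beta>' * \<rho>')"
    "\<beta>' * \<rho>' = of_int 0 * \<beta>' + of_int 1 * (\<beta>' * \<rho>')"
    by simp_all
  then have "\<beta>' \<in> lattice_of_descriptors \<beta>' \<rho>'" "\<beta>' * \<rho>' \<in> lattice_of_descriptors \<beta>' \<rho>'"
    unfolding lattice_of_descriptors_def lattice_of_basis_def by blast+
  then have "?L \<longleftrightarrow> \<beta>' \<in> lattice_of_descriptors \<beta> \<rho> \<and> \<beta>' * \<rho>' \<in> lattice_of_descriptors \<beta> \<rho>"
    using lattice_of_basis_subset unfolding lattice_of_descriptors_def by blast
  also have "\<dots> \<longleftrightarrow> ?R"
    unfolding mem by blast
  finally show ?thesis .
qed

theorem theorem3p6: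
  fixes \<beta> \<beta>' \<rho> \<rho>' :: complex
  assumes "\<beta> \<noteq> 0" and "\<beta>' \<noteq> 0"
    and "\<rho> \<in> shape_descriptors" and "\<rho>' \<in> shape_descriptors"
  shows "lattice_of_descriptors \<beta> \<rho> = lattice_of_descriptors \<beta>' \<rho>' \<longleftrightarrow>
    (\<exists>k1 k2 k3 k4 :: int. k1 * k4 - k2 * k3 = 1 \<and>
       \<beta>' = exp (\<i> * of_real (Arg (of_int k1 + of_int k2 * \<rho>))) * \<beta> \<and>
       \<rho>' = (of_int k3 + of_int k4 * \<rho>) / (of_int k1 + of_int k2 * \<rho>))"
    (is "?L \<longleftrightarrow> ?R")
proof
  assume ?L
  then obtain k1 k2 k3 k4 l1 l2 l3 l4 :: int
    where k: "\<beta>' = (of_int k1 + of_int k2 * \<rho>) * \<beta>"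
        "\<beta>' * \<rho>' = (of_int k3 + of_int k4 * \<rho>) * \<beta>"
      and l: "\<beta> = (of_int l1 + of_int l2 * \<rho>') * \<beta>'"
        "\<beta> * \<rho> = (of_int l3 + of_int l4 * \<rho>') * \<beta>'"
    using lattice_of_descriptors_subset_iff[of \<beta> \<rho> \<beta>' \<rho>']
      lattice_of_descriptors_subset_iff[of \<beta>' \<rho>' \<beta> \<rho>] by blast
  define u where "u = of_int k1 + of_int k2 * \<rho>"
  define v where "v = of_int l1 + of_int l2 * \<rho>'"
  have "u \<noteq> 0" "v \<noteq> 0"
    using k(1) l(1) assms by (auto simp: u_def v_def)
  then have "1 \<le> norm u" "1 \<le> norm v"
    using norm_lattice_vector_ge_1 assms unfolding u_def v_def by blast+
  \<comment> \<open>Substituting one change of scale into the other gives \<open>v * u = 1\<close>;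
    two norms that are at least 1 and have product 1 must both be 1.\<close>
  moreover have "\<beta> = (v * u) * \<beta>"
    using k(1) l(1) unfolding u_def[symmetric] v_def[symmetric] by (metis mult.assoc)
  then have "v * u = 1"
    using \<open>\<beta> \<noteq> 0\<close> by simp
  then have "norm v * norm u = 1"
    by (metis norm_mult norm_one)
  ultimately have "norm u = 1" "norm v = 1"
    by (smt (verit) mult_le_cancel_left1 mult_le_cancel_right1)+
  have \<rho>': "\<rho>' = (of_int k3 + of_int k4 * \<rho>) / u"
    using quotient_eqI[OF assms(2) k] by (simp add: u_def)
  have \<rho>: "\<rho> = (of_int l3 + of_int l4 * \<rho>') / v"
    using quotient_eqI[OF assms(1) l] by (simp add: v_def)
  have Im: "Im \<rho>' = of_int (k1 * k4 - k2 * k3) * Im \<rho>"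
    using Im_moebius[where a = k1 and b = k2 and c = k3 and d = k4 and z = \<rho>] \<rho>' \<open>norm u = 1\<close>
    by (simp add: u_def)
  have Im': "Im \<rho> = of_int (l1 * l4 - l2 * l3) * Im \<rho>'"
    using Im_moebius[where a = l1 and b = l2 and c = l3 and d = l4 and z = \<rho>'] \<rho> \<open>norm v = 1\<close>
    by (simp add: v_def)
  have pos: "0 < Im \<rho>" "0 < Im \<rho>'"
    using assms by (auto simp: shape_descriptors_def)
  have "0 < real_of_int (k1 * k4 - k2 * k3)"
    using Im pos by (metis zero_less_mult_pos2)
  \<comment> \<open>Composing the two relations between imaginary parts shows that the integer
    determinants have product 1; as the first is positive, it equals 1.\<close>
  moreover have "real_of_int ((l1 * l4 - l2 * l3) * (k1 * k4 - k2 * k3)) * Im \<rho> = Im \<rho>"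
    using Im Im' by (metis mult.assoc of_int_mult)
  then have "real_of_int ((l1 * l4 - l2 * l3) * (k1 * k4 - k2 * k3)) = 1"
    using pos by (simp del: of_int_mult of_int_diff)
  then have "(l1 * l4 - l2 * l3) * (k1 * k4 - k2 * k3) = 1"
    by (simp only: of_int_eq_1_iff)
  ultimately have "k1 * k4 - k2 * k3 = 1"
    by (metis of_int_0_less_iff pos_zmult_eq_1_iff mult.commute)
  moreover have "\<beta>' = exp (\<i> * of_real (Arg u)) * \<beta>"
    using k(1) exp_i_Arg[OF \<open>norm u = 1\<close>] by (simp add: u_def)
  ultimately show ?R
    using \<rho>' unfolding u_def by blast
next
  assume ?R
  then obtain k1 k2 k3 k4 :: int
    where det: "k1 * k4 - k2 * k3 = 1"
      and \<beta>': "\<beta>' = exp (\<i> * of_real (Arg (of_int k1 + of_int k2 * \<rho>))) * \<beta>"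
      and \<rho>': "\<rho>' = (of_int k3 + of_int k4 * \<rho>) / (of_int k1 + of_int k2 * \<rho>)"
    by blast
  define u where "u = of_int k1 + of_int k2 * \<rho>"
  \<comment> \<open>The coefficients are the first row of the inverse matrix
    \<open>(k4, -k2; -k3, k1)\<close>, which is integral because the determinant is 1. This makes
    \<open>v\<close> the inverse of \<open>u\<close>.\<close>
  define v where "v = of_int k4 + of_int (- k2) * \<rho>'"
  have "of_int (k1 * k4 - k2 * k3) = (1 :: complex)"
    unfolding det by simp
  then have det': "of_int k1 * of_int k4 - of_int k2 * of_int k3 = (1 :: complex)"
    by simp
  \<comment> \<open>If \<open>u\<close> were 0, division by zero would give \<rho>' = 0, which is
    not a shape descriptor.\<close>
  have "u \<noteq> 0"
    using \<rho>' assms(4) by (auto simp: u_def shape_descriptors_def)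
  then have u\<rho>': "u * \<rho>' = of_int k3 + of_int k4 * \<rho>"
    using \<rho>' by (simp add: u_def)
  have "v * u = of_int k4 * u - of_int k2 * (u * \<rho>')"
    by (simp add: v_def algebra_simps)
  also have "\<dots> = 1"
    unfolding u\<rho>' using det' by (simp add: u_def algebra_simps)
  finally have "v * u = 1" .
  then have "v \<noteq> 0"
    by auto
  then have "1 \<le> norm u" "1 \<le> norm v"
    using norm_lattice_vector_ge_1 assms \<open>u \<noteq> 0\<close> unfolding u_def v_def by blast+
  moreover have "norm v * norm u = 1"
    using \<open>v * u = 1\<close> by (metis norm_mult norm_one)
  ultimately have "norm u = 1"
    by (smt (verit) mult_le_cancel_left1 mult_le_cancel_right1)
  \<comment> \<open>On the unit circle the rotation by \<open>Arg u\<close> is multiplication by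
    \<open>u\<close> itself, so the new scale is a vector of the old lattice.\<close>
  then have \<beta>u: "\<beta>' = u * \<beta>"
    using \<beta>' exp_i_Arg[of u] by (simp add: u_def)
  have "\<beta>' * \<rho>' = (of_int k3 + of_int k4 * \<rho>) * \<beta>"
    using u\<rho>' \<beta>u by (simp add: mult_ac)
  then have "lattice_of_descriptors \<beta>' \<rho>' \<subseteq> lattice_of_descriptors \<beta> \<rho>"
    using \<beta>u unfolding u_def lattice_of_descriptors_subset_iff by blast
  moreover have "\<beta> = v * \<beta>'"
    using \<beta>u \<open>v * u = 1\<close> by (simp add: mult.assoc[symmetric])
  \<comment> \<open>The second row of the inverse matrix supplies these coefficients, completing the
    reverse inclusion.\<close>
  moreover have "\<beta> * \<rho> = (of_int (- k3) + of_int k1 * \<rho>') * \<beta>'"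
  proof -
    have "(of_int (- k3) + of_int k1 * \<rho>') * u = of_int k1 * (u * \<rho>') - of_int k3 * u"
      by (simp add: algebra_simps)
    also have "\<dots> = (of_int k1 * of_int k4 - of_int k2 * of_int k3) * \<rho>"
      unfolding u\<rho>' by (simp add: u_def algebra_simps)
    finally show ?thesis
      by (simp add: det' \<beta>u mult.assoc[symmetric] mult.commute)
  qed
  ultimately show ?L
    unfolding v_def using lattice_of_descriptors_subset_iff[of \<beta> \<rho> \<beta>' \<rho>'] by blast
qed

end
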